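(* The following two statements are equivalent. (a) (Tomaszewski's conjecture) For every $n\in\mathbb{N}$ and every $a\in\mathbb{R}^n$, $P(|a\cdot\epsilon|\le\|a\|)\ge\frac12$. (b) For every $n\in\mathbb{N}$ and all $l_1,\dots,l_n\in\mathbb{N}$, $$\frac{1}{2^n}\left|\left\{J\subseteq I_n:\ \sum_{(i,j)\in J^{(2)}\cup J_c^{(2)}} l_il_j-\sum_{(i,j)\in J\times J_c} l_il_j\le 0\right\}\right|\ge\frac12 .$$
   Context: $\mathbb{N}=\{1,2,\dots\}$. $\epsilon=(\epsilon_1,\dots,\epsilon_n)$, where $\epsilon_1,\dots,\epsilon_n$ are independent random variables with $P(\epsilon_i=1)=P(\epsilon_i=-1)=\frac12$. For $a=(a_1,\dots,a_n)\in\mathbb{R}^n$, $a\cdot\epsilon=a_1\epsilon_1+\cdots+a_n\epsilon_n$ and $\|a\|=(\sum_{i=1}^n a_i^2)^{1/2}$. $I_n=\{1,\dots,n\}$. For $J\subseteq I_n$, $J_c=I_n-J$ is the complement and $J^{(2)}=\{(i,j): i,j\in J,\ i<j\}$; $J_c^{(2)}$ means $(J_c)^{(2)}$. For a finite set $S$, $|S|$ is its cardinality. Empty sums are $0$. *)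

theory Defs
  imports "HOL-Probability.Probability"
begin

definition rademacher :: "'a measure \<Rightarrow> nat \<Rightarrow> (nat \<Rightarrow> 'a \<Rightarrow> real) \<Rightarrow> bool" where
  "rademacher M n \<epsilon> \<longleftrightarrow>
     prob_space M \<and> prob_space.indep_vars M (\<lambda>_. borel) \<epsilon> {1..n} \<and>
     (\<forall>i\<in>{1..n}. measure M {\<omega> \<in> space M. \<epsilon> i \<omega> = 1} = 1/2 \<and>
                 measure M {\<omega> \<in> space M. \<epsilon> i \<omega> = -1} = 1/2)"

text \<open>Such variables exist for every \<open>n\<close>, so the hypothesis \<open>rademacher\<close> is satisfiable.\<close>

lemma rademacher_exists:
  "rademacher (measure_pmf (Pi_pmf {1..n} 0 (\<lambda>_. pmf_of_set {1, -1::real}))) n (\<lambda>i \<omega>. \<omega> i)"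
proof -
  let ?p = "Pi_pmf {1..n} 0 (\<lambda>_. pmf_of_set {1, -1::real})"
  have comp: "measure_pmf.prob ?p {\<omega>. \<omega> i = s} = 1/2" if "i \<in> {1..n}" "s \<in> {1, -1}" for i s
  proof -
    have "map_pmf (\<lambda>\<omega>. \<omega> i) ?p = pmf_of_set {1, -1}"
      using that by (subst Pi_pmf_component) auto
    then have "measure_pmf.prob (pmf_of_set {1, -1::real}) {s}
        = measure_pmf.prob (map_pmf (\<lambda>\<omega>. \<omega> i) ?p) {s}"
      by simp
    then show ?thesis
      using that(2) by (auto simp: vimage_def measure_pmf_single pmf_map)
  qed
  have "prob_space.indep_vars (measure_pmf ?p) (\<lambda>_. count_space UNIV) (\<lambda>i \<omega>. \<omega> i) {1..n}"
    by (intro indep_vars_Pi_pmf) auto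
  then have "prob_space.indep_vars (measure_pmf ?p) (\<lambda>_. borel) (\<lambda>i. (\<lambda>x. x) \<circ> (\<lambda>\<omega>. \<omega> i)) {1..n}"
    by (rule prob_space.indep_vars_compose[OF measure_pmf.prob_space_axioms]) auto
  then show ?thesis
    using comp by (simp add: rademacher_def o_def measure_pmf.prob_space_axioms)
qed

definition pairs :: "nat set \<Rightarrow> (nat \<times> nat) set" where
  "pairs J = {(i, j). i \<in> J \<and> j \<in> J \<and> i < j}"

end

theory Submission
  imports Defs
begin

text \<open>
  Both statements count sign patterns.  A subset \<open>J\<close> of \<open>{1..n}\<close> encodes the pattern that is \<open>1\<close> on
  \<open>J\<close> and \<open>-1\<close> off \<open>J\<close>; each pattern has probability \<open>1 / 2^n\<close>, so the probability in (a) is the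
  proportion of those \<open>J\<close> whose signed sum is at most the Euclidean norm in absolute value
  (\<open>rademacher_prob_eq_card\<close>).  Expanding the square of the signed sum gives the sum of the
  squares of the coefficients plus twice the form in (b), so the condition on \<open>J\<close> says precisely that
  this form is nonpositive (\<open>abs_signed_sum_le_L2_set_iff\<close>).  Hence (b) is (a) for coefficients
  that are positive integers, and it remains to pass from these to arbitrary real coefficients.

  Three facts do this.  Changing signs of coefficients only permutes the patterns, so the
  coefficients may be taken nonnegative (\<open>card_good_subsets_abs\<close>).  Positive scaling does not
  change the sign of the form, so positive rationals with a common denominator are as good as
  positive integers (\<open>good_subsets_scale\<close>), and they are dense.  Finally, a pattern for which the
  form is strictly positive keeps this property under small perturbations.  So the number of
  good patterns at a limit is at least the number at nearby points
  (\<open>eventually_good_subsets_subset\<close>), which is the direction needed to carry a lower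
  bound to the limit.
\<close>

section \<open>Sign patterns and the quadratic form\<close>

definition signed_sum :: "nat \<Rightarrow> nat set \<Rightarrow> (nat \<Rightarrow> real) \<Rightarrow> real" where
  "signed_sum n J a = (\<Sum>i=1..n. a i * (if i \<in> J then 1 else -1))"

definition pair_form :: "nat \<Rightarrow> nat set \<Rightarrow> (nat \<Rightarrow> real) \<Rightarrow> real" where
  "pair_form n J a =
     (\<Sum>(i,j)\<in>pairs J \<union> pairs ({1..n} - J). a i * a j) - (\<Sum>(i,j)\<in>J \<times> ({1..n} - J). a i * a j)"

definition good_subsets :: "nat \<Rightarrow> (nat \<Rightarrow> real) \<Rightarrow> nat set set" where
  "good_subsets n a = {J. J \<subseteq> {1..n} \<and> pair_form n J a \<le> 0}"

lemma finite_pairs [simp]: "finite J \<Longrightarrow> finite (pairs J)"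
  by (rule finite_subset[of _ "J \<times> J"]) (auto simp: pairs_def)

lemma finite_good_subsets [simp]: "finite (good_subsets n a)"
  by (rule finite_subset[of _ "Pow {1..n}"]) (auto simp: good_subsets_def)

lemma sum_squared_eq_pairs:
  fixes a :: "nat \<Rightarrow> real"
  assumes "finite J"
  shows "(\<Sum>i\<in>J. a i)\<^sup>2 = (\<Sum>i\<in>J. (a i)\<^sup>2) + 2 * (\<Sum>(i,j)\<in>pairs J. a i * a j)"
proof -
  let ?f = "\<lambda>(i,j). a i * a j"
  have split: "J \<times> J = (\<lambda>i. (i,i)) ` J \<union> (pairs J \<union> prod.swap ` pairs J)"
    by (auto simp: pairs_def image_iff)
  have "(\<Sum>i\<in>J. a i)\<^sup>2 = sum ?f (J \<times> J)"
    by (simp add: power2_eq_square sum_product sum.cartesian_product)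
  also have "\<dots> = sum ?f ((\<lambda>i. (i,i)) ` J) + sum ?f (pairs J \<union> prod.swap ` pairs J)"
    unfolding split by (rule sum.union_disjoint) (simp_all add: assms, auto simp: pairs_def)
  also have "sum ?f (pairs J \<union> prod.swap ` pairs J) = sum ?f (pairs J) + sum ?f (prod.swap ` pairs J)"
    by (rule sum.union_disjoint) (simp_all add: assms, auto simp: pairs_def)
  also have "sum ?f (prod.swap ` pairs J) = sum ?f (pairs J)"
    by (subst sum.reindex) (auto simp: split_beta mult.commute intro: sum.cong)
  also have "sum ?f ((\<lambda>i. (i,i)) ` J) = (\<Sum>i\<in>J. (a i)\<^sup>2)"
    by (subst sum.reindex) (auto simp: inj_on_def power2_eq_square)
  finally show ?thesis by simp
qed

lemma signed_sum_squared:
  assumes "J \<subseteq> {1..n}"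
  shows "(signed_sum n J a)\<^sup>2 = (\<Sum>i=1..n. (a i)\<^sup>2) + 2 * pair_form n J a"
proof -
  let ?K = "{1..n} - J"
  have fin: "finite J" "finite ?K" using assms finite_subset by auto
  have I: "{1..n} = J \<union> ?K" using assms by auto
  have split: "sum f {1..n} = sum f J + sum f ?K" for f :: "nat \<Rightarrow> real"
    by (subst I, rule sum.union_disjoint) (use fin in auto)
  have "signed_sum n J a = sum a J - sum a ?K"
    unfolding signed_sum_def split by (simp add: sum_negf)
  then have "(signed_sum n J a)\<^sup>2 = (sum a J)\<^sup>2 + (sum a ?K)\<^sup>2 - 2 * (sum a J * sum a ?K)"
    by (simp add: power2_diff)
  moreover have "sum a J * sum a ?K = (\<Sum>(i,j)\<in>J \<times> ?K. a i * a j)"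
    by (simp add: sum_product sum.cartesian_product)
  moreover have "(\<Sum>(i,j)\<in>pairs J \<union> pairs ?K. a i * a j)
      = (\<Sum>(i,j)\<in>pairs J. a i * a j) + (\<Sum>(i,j)\<in>pairs ?K. a i * a j)"
    by (rule sum.union_disjoint) (simp_all add: fin, auto simp: pairs_def)
  ultimately show ?thesis
    unfolding split pair_form_def sum_squared_eq_pairs[OF fin(1)] sum_squared_eq_pairs[OF fin(2)]
    by simp
qed

lemma abs_signed_sum_le_L2_set_iff:
  assumes "J \<subseteq> {1..n}"
  shows "\<bar>signed_sum n J a\<bar> \<le> L2_set a {1..n} \<longleftrightarrow> pair_form n J a \<le> 0"
proof -
  have "\<bar>signed_sum n J a\<bar> = sqrt ((\<Sum>i=1..n. (a i)\<^sup>2) + 2 * pair_form n J a)"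
    unfolding signed_sum_squared[OF assms, symmetric] by simp
  then show ?thesis by (simp add: L2_set_def)
qed

lemma good_subsets_eq_signed_sum:
  "good_subsets n a = {J. J \<subseteq> {1..n} \<and> \<bar>signed_sum n J a\<bar> \<le> L2_set a {1..n}}"
  unfolding good_subsets_def using abs_signed_sum_le_L2_set_iff by blast

section \<open>The probability of a sign pattern\<close>

lemma rademacher_sign_pattern:
  assumes "rademacher M n \<epsilon>" "n \<ge> 1"
  shows "measure M (\<Inter>i\<in>{1..n}. {\<omega> \<in> space M. \<epsilon> i \<omega> = (if i \<in> J then 1 else -1)}) = 1 / 2^n"
proof -
  let ?s = "\<lambda>i. if i \<in> J then 1 else -1 :: real"
  interpret prob_space M using assms(1) by (simp add: rademacher_def)
  have indep: "indep_vars (\<lambda>_. borel) \<epsilon> {1..n}"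
    using assms(1) by (simp add: rademacher_def)
  have pre: "\<epsilon> i -` {?s i} \<inter> space M = {\<omega> \<in> space M. \<epsilon> i \<omega> = ?s i}" for i
    by auto
  have "prob (\<Inter>i\<in>{1..n}. \<epsilon> i -` {?s i} \<inter> space M) = (\<Prod>i\<in>{1..n}. prob (\<epsilon> i -` {?s i} \<inter> space M))"
    by (rule indep_varsD[OF indep]) (use assms(2) in auto)
  also have "\<dots> = (\<Prod>i\<in>{1..n}. 1/2)"
    unfolding pre using assms(1) by (intro prod.cong) (auto simp: rademacher_def)
  finally show ?thesis
    unfolding pre by (simp add: power_one_over)
qed

text \<open>
  The \<open>2^n\<close> disjoint pattern events have total mass \<open>1\<close>.  The patterns whose signed sum
  is at most \<open>c\<close> in absolute value bound the probability of the event from below, and the remaining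
  ones bound that of its complement from below; the bounds add up to \<open>1\<close>, so both are
  equalities.  In this way values of the variables other than \<open>1\<close> and \<open>-1\<close> never have to be
  treated separately.
\<close>
lemma rademacher_prob_eq_card:
  assumes R: "rademacher M n \<epsilon>" "n \<ge> 1"
  shows "measure M {\<omega> \<in> space M. \<bar>\<Sum>i=1..n. a i * \<epsilon> i \<omega>\<bar> \<le> c}
       = real (card {J. J \<subseteq> {1..n} \<and> \<bar>signed_sum n J a\<bar> \<le> c}) / 2^n"
proof -
  interpret prob_space M using R(1) by (simp add: rademacher_def)
  let ?s = "\<lambda>J i. if i \<in> J then 1 else -1 :: real"
  define A where "A J = (\<Inter>i\<in>{1..n}. {\<omega> \<in> space M. \<epsilon> i \<omega> = ?s J i})" for J
  define E where "E = {\<omega> \<in> space M. \<bar>\<Sum>i=1..n. a i * \<epsilon> i \<omega>\<bar> \<le> c}"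
  define G where "G = {J. J \<subseteq> {1..n} \<and> \<bar>signed_sum n J a\<bar> \<le> c}"
  have meas [measurable]: "\<epsilon> i \<in> borel_measurable M" if "i \<in> {1..n}" for i
    using R(1) that by (auto simp: rademacher_def indep_vars_def)
  have E: "E \<in> events" unfolding E_def by measurable
  have A: "A J \<in> events" for J
    unfolding A_def using R(2) by (intro sets.finite_INT) auto
  have A_E: "\<omega> \<in> space M \<and> (\<omega> \<in> E \<longleftrightarrow> J \<in> G)" if "J \<subseteq> {1..n}" "\<omega> \<in> A J" for \<omega> J
  proof -
    have "(\<Sum>i=1..n. a i * \<epsilon> i \<omega>) = signed_sum n J a"
      unfolding signed_sum_def using that(2) by (intro sum.cong) (auto simp: A_def)
    moreover have "\<omega> \<in> space M"
      using that(2) A sets.sets_into_space by blast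
    ultimately show ?thesis using that(1) unfolding E_def G_def by simp
  qed
  have GF: "G \<subseteq> Pow {1..n}" by (auto simp: G_def)
  then have fin: "finite G" by (rule finite_subset) simp
  have disj: "disjoint_family_on A (Pow {1..n})"
    unfolding disjoint_family_on_def
  proof (intro ballI impI)
    fix J K assume JK: "J \<in> Pow {1..n}" "K \<in> Pow {1..n}" "J \<noteq> K"
    then obtain i where i: "i \<in> {1..n}" "i \<in> J \<longleftrightarrow> i \<notin> K" by blast
    have "\<epsilon> i \<omega> = ?s J i" "\<epsilon> i \<omega> = ?s K i" if "\<omega> \<in> A J \<inter> A K" for \<omega>
      using that i(1) unfolding A_def by blast+
    then show "A J \<inter> A K = {}" using i(2) by (force split: if_splits)
  qed
  have mass: "prob (\<Union>J\<in>F. A J) = real (card F) / 2^n" if F: "F \<subseteq> Pow {1..n}" for F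
  proof -
    have "prob (\<Union>J\<in>F. A J) = (\<Sum>J\<in>F. prob (A J))"
      by (intro finite_measure_finite_Union)
        (use A disj F finite_subset[OF F] in \<open>auto intro: disjoint_family_on_mono\<close>)
    also have "\<dots> = (\<Sum>J\<in>F. 1 / 2^n)"
      unfolding A_def rademacher_sign_pattern[OF R] ..
    finally show ?thesis by simp
  qed
  have "prob (\<Union>J\<in>G. A J) \<le> prob E"
    by (intro finite_measure_mono E) (use A_E GF in blast)
  moreover have "prob (\<Union>J\<in>Pow {1..n} - G. A J) \<le> prob (space M - E)"
    by (intro finite_measure_mono sets.compl_sets E) (use A_E in blast)
  moreover have "real (card (Pow {1..n} - G)) = 2^n - real (card G)"
    using card_mono[OF _ GF] by (simp add: card_Diff_subset[OF fin GF] card_Pow del: One_nat_def)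
  ultimately have "prob E = real (card G) / 2^n"
    using GF by (simp add: mass prob_compl[OF E] diff_divide_distrib)
  then show ?thesis by (simp add: E_def G_def)
qed

section \<open>Reduction to positive integer coefficients\<close>

text \<open>
  Flipping the pattern at the negative coefficients, that is, taking the symmetric difference of
  \<open>J\<close> with the set of their indices, turns the signed sum of \<open>\<bar>a\<bar>\<close> into that of \<open>a\<close>.
\<close>
lemma card_good_subsets_abs: "card (good_subsets n (\<lambda>i. \<bar>a i\<bar>)) = card (good_subsets n a)"
proof -
  define N where "N = {i \<in> {1..n}. a i < 0}"
  let ?flip = "\<lambda>J. (J - N) \<union> (N - J)"
  have flip: "signed_sum n (?flip J) a = signed_sum n J (\<lambda>i. \<bar>a i\<bar>)" for J
    unfolding signed_sum_def by (intro sum.cong) (auto simp: N_def)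
  have flip': "signed_sum n (?flip J) (\<lambda>i. \<bar>a i\<bar>) = signed_sum n J a" for J
    unfolding signed_sum_def by (intro sum.cong) (auto simp: N_def)
  have norm: "L2_set (\<lambda>i. \<bar>a i\<bar>) {1..n} = L2_set a {1..n}"
    by (simp add: L2_set_def)
  have N: "N \<subseteq> {1..n}" by (auto simp: N_def)
  have "bij_betw ?flip (good_subsets n (\<lambda>i. \<bar>a i\<bar>)) (good_subsets n a)"
    by (rule bij_betw_byWitness[where f' = ?flip])
      (use N in \<open>auto simp: good_subsets_eq_signed_sum flip flip' norm simp del: One_nat_def\<close>)
  then show ?thesis by (rule bij_betw_same_card)
qed

lemma good_subsets_scale:
  assumes "c > 0"
  shows "good_subsets n (\<lambda>i. c * a i) = good_subsets n a"
proof -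
  have "pair_form n J (\<lambda>i. c * a i) = c\<^sup>2 * pair_form n J a" for J
    by (simp add: pair_form_def right_diff_distrib sum_distrib_left split_beta
        power2_eq_square ac_simps)
  then show ?thesis
    using assms by (simp add: good_subsets_def mult_le_0_iff)
qed

text \<open>
  By continuity, each of the finitely many patterns with a strictly positive form at the limit has
  a positive form from some point of the sequence on.  The reverse inclusion can fail, since a
  form that vanishes at the limit may be positive along the sequence.
\<close>
lemma eventually_good_subsets_subset:
  assumes lim: "\<And>i. (\<lambda>k. x k i) \<longlonglongrightarrow> a i"
  shows "eventually (\<lambda>k. good_subsets n (x k) \<subseteq> good_subsets n a) sequentially"
proof -
  let ?B = "Pow {1..n} - good_subsets n a"
  have "eventually (\<lambda>k. pair_form n J (x k) > 0) sequentially" if "J \<in> ?B" for J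
  proof -
    have "(\<lambda>k. pair_form n J (x k)) \<longlonglongrightarrow> pair_form n J a"
      unfolding pair_form_def split_beta by (intro tendsto_intros lim)
    moreover have "pair_form n J a > 0"
      using that by (auto simp: good_subsets_def)
    ultimately show ?thesis by (rule order_tendstoD)
  qed
  then have "eventually (\<lambda>k. \<forall>J\<in>?B. pair_form n J (x k) > 0) sequentially"
    by (intro eventually_ball_finite) auto
  then show ?thesis
  proof eventually_elim
    case (elim k)
    show ?case
    proof
      fix J assume J: "J \<in> good_subsets n (x k)"
      then have "J \<subseteq> {1..n}" "\<not> pair_form n J (x k) > 0" by (auto simp: good_subsets_def)
      then show "J \<in> good_subsets n a" using elim by blast
    qed
  qed
qed

text \<open>
  The integers are numerators of a rational approximation of \<open>\<bar>a\<bar>\<close> with a common denominator.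
  Approximating from above makes them positive also where \<open>a\<close> vanishes.
\<close>
lemma card_good_subsets_ge_positive_integers:
  obtains l :: "nat \<Rightarrow> nat"
  where "\<And>i. l i \<ge> 1" "card (good_subsets n (\<lambda>i. real (l i))) \<le> card (good_subsets n a)"
proof -
  define l where "l k i = nat \<lfloor>real (Suc k) * \<bar>a i\<bar>\<rfloor> + 1" for k i
  define x where "x k i = inverse (real (Suc k)) * real (l k i)" for k i
  have "(\<lambda>k. x k i) \<longlonglongrightarrow> \<bar>a i\<bar>" for i
  proof (rule tendsto_sandwich[OF always_eventually always_eventually])
    have bounds: "real (Suc k) * \<bar>a i\<bar> \<le> real (l k i)"
      "real (l k i) \<le> real (Suc k) * \<bar>a i\<bar> + 1" for k
    proof -
      have "real (l k i) = of_int \<lfloor>real (Suc k) * \<bar>a i\<bar>\<rfloor> + 1"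
        unfolding l_def by simp
      then show "real (Suc k) * \<bar>a i\<bar> \<le> real (l k i)"
        "real (l k i) \<le> real (Suc k) * \<bar>a i\<bar> + 1" by linarith+
    qed
    show "\<forall>k. \<bar>a i\<bar> \<le> x k i"
      using bounds(1) by (simp add: x_def field_simps del: of_nat_Suc)
    show "\<forall>k. x k i \<le> \<bar>a i\<bar> + inverse (real (Suc k))"
      using bounds(2) by (simp add: x_def field_simps del: of_nat_Suc)
    show "(\<lambda>k. \<bar>a i\<bar>) \<longlonglongrightarrow> \<bar>a i\<bar>" by simp
    show "(\<lambda>k. \<bar>a i\<bar> + inverse (real (Suc k))) \<longlonglongrightarrow> \<bar>a i\<bar>"
      by (rule LIMSEQ_inverse_real_of_nat_add)
  qed
  then have "eventually (\<lambda>k. good_subsets n (x k) \<subseteq> good_subsets n (\<lambda>i. \<bar>a i\<bar>)) sequentially"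
    by (rule eventually_good_subsets_subset)
  then obtain k where k: "good_subsets n (x k) \<subseteq> good_subsets n (\<lambda>i. \<bar>a i\<bar>)"
    using eventually_happens'[OF sequentially_bot] by blast
  have "good_subsets n (x k) = good_subsets n (\<lambda>i. real (l k i))"
    unfolding x_def by (rule good_subsets_scale) simp
  then have "card (good_subsets n (\<lambda>i. real (l k i))) \<le> card (good_subsets n a)"
    using card_mono[OF _ k] by (simp add: card_good_subsets_abs)
  then show thesis by (intro that[of "l k"]) (simp_all add: l_def)
qed

lemma good_subsets_of_nat:
  "good_subsets n (\<lambda>i. real (l i)) =
     {J. J \<subseteq> {1..n} \<and>
       (\<Sum>(i,j)\<in>pairs J \<union> pairs ({1..n} - J). int (l i * l j))
       - (\<Sum>(i,j)\<in>J \<times> ({1..n} - J). int (l i * l j)) \<le> 0}"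
proof -
  have "pair_form n J (\<lambda>i. real (l i)) = of_int
      ((\<Sum>(i,j)\<in>pairs J \<union> pairs ({1..n} - J). int (l i * l j))
       - (\<Sum>(i,j)\<in>J \<times> ({1..n} - J). int (l i * l j)))" for J
    by (simp add: pair_form_def split_beta)
  then show ?thesis
    unfolding good_subsets_def by (simp only: of_int_le_0_iff)
qed

section \<open>The equivalence\<close>

theorem theorem2p4:
  fixes M :: "nat \<Rightarrow> 'a measure" and \<epsilon> :: "nat \<Rightarrow> nat \<Rightarrow> 'a \<Rightarrow> real"
  assumes "\<And>n. n \<ge> 1 \<Longrightarrow> rademacher (M n) n (\<epsilon> n)"
  shows "(\<forall>n\<ge>1. \<forall>a :: nat \<Rightarrow> real.
            measure (M n) {\<omega> \<in> space (M n). \<bar>\<Sum>i=1..n. a i * \<epsilon> n i \<omega>\<bar> \<le> L2_set a {1..n}} \<ge> 1/2)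
     \<longleftrightarrow>
         (\<forall>n\<ge>1. \<forall>l :: nat \<Rightarrow> nat. (\<forall>i\<in>{1..n}. l i \<ge> 1) \<longrightarrow>
            1 / 2^n * real (card {J. J \<subseteq> {1..n} \<and>
               (\<Sum>(i,j)\<in>pairs J \<union> pairs ({1..n} - J). int (l i * l j))
               - (\<Sum>(i,j)\<in>J \<times> ({1..n} - J). int (l i * l j)) \<le> 0}) \<ge> 1/2)"
    (is "?A \<longleftrightarrow> ?B")
proof -
  have prob: "measure (M n) {\<omega> \<in> space (M n). \<bar>\<Sum>i=1..n. a i * \<epsilon> n i \<omega>\<bar> \<le> L2_set a {1..n}}
      = 1 / 2^n * real (card (good_subsets n a))" if "n \<ge> 1" for n a
    unfolding rademacher_prob_eq_card[OF assms[OF that] that] good_subsets_eq_signed_sum by simp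
  have A: "?A \<longleftrightarrow> (\<forall>n\<ge>1. \<forall>a. 1 / 2^n * real (card (good_subsets n a)) \<ge> 1/2)"
    by (simp only: prob cong: imp_cong)
  show ?thesis
    unfolding A good_subsets_of_nat[symmetric]
  proof (intro iffI allI impI)
    fix n :: nat and a :: "nat \<Rightarrow> real"
    assume B: "\<forall>n\<ge>1. \<forall>l. (\<forall>i\<in>{1..n}. l i \<ge> 1) \<longrightarrow>
        1 / 2^n * real (card (good_subsets n (\<lambda>i. real (l i)))) \<ge> 1/2" and n: "n \<ge> 1"
    obtain l :: "nat \<Rightarrow> nat" where l: "\<And>i. l i \<ge> 1"
      "card (good_subsets n (\<lambda>i. real (l i))) \<le> card (good_subsets n a)"
      using card_good_subsets_ge_positive_integers[of n a] by blast
    have "1/2 \<le> 1 / 2^n * real (card (good_subsets n (\<lambda>i. real (l i))))"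
      using B n l(1) by blast
    also have "\<dots> \<le> 1 / 2^n * real (card (good_subsets n a))"
      using l(2) by (intro mult_left_mono) auto
    finally show "1/2 \<le> 1 / 2^n * real (card (good_subsets n a))" .
  qed blast
qed

end
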